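(* Let $n$ and $\ell$ be integers and $\Sigma$ an alphabet of size $|\Sigma|\geq 4$. Let $m\geq 2\lceil\log \ell\rceil$, $\Delta\leq \ell$ and $\epsilon>0$. Let $\mathrm{Alg}$ be an $\epsilon$-differentially private algorithm which takes as input any database $\mathcal{D}=S_1,\dots,S_n$ of documents in $\Sigma^{\ell}$ and a threshold $\tau$. If, for every such input, $\mathrm{Alg}$ computes with probability at least $2/3$ a set $\mathcal{P}$ such that for every $P\in\Sigma^{m}$: (1) if $\mathrm{count}_{\Delta}(P,\mathcal{D})\geq\tau+\alpha$ then $P\in\mathcal{P}$, and (2) if $\mathrm{count}_{\Delta}(P,\mathcal{D})\leq\tau-\alpha$ then $P\notin\mathcal{P}$, then $\alpha=\Omega(\min(n,\epsilon^{-1}\ell\log |\Sigma|))$.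
   Context: For strings $P,S$, $\mathrm{count}(P,S)$ is the number of positions $i$ with $S[i]\cdots S[i+|P|-1]=P$; $\mathrm{count}_{\Delta}(P,S)=\min(\Delta,\mathrm{count}(P,S))$, and $\mathrm{count}_{\Delta}(P,\mathcal{D})=\sum_{S\in\mathcal{D}}\mathrm{count}_{\Delta}(P,S)$ for a database (multiset) $\mathcal{D}$ of documents. Two databases are neighboring if one is obtained from the other by replacing one document by another. An algorithm $A$ is $\epsilon$-differentially private if for all neighboring $\mathcal{D},\mathcal{D}'$ (and any fixed threshold input) and all sets $U$ of outputs, $\Pr[A(\mathcal{D})\in U]\leq e^{\epsilon}\Pr[A(\mathcal{D}')\in U]$. $\log$ is the binary logarithm; $\Omega(\cdot)$ hides an absolute positive constant.
   Formalization: Adds 1 ≤ m ≤ ℓ and Δ ≥ 1 (otherwise counts do not depend on the database and the claim fails), and asserts the bound only if α ≥ 1 or min(n, ε⁻¹ℓ log|Σ|) is at least an absolute constant K, since for very large ε exact private algorithms exist. *)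

theory Defs
  imports "HOL-Probability.Probability" "HOL-Library.Multiset"
begin

definition words :: "'a set \<Rightarrow> nat \<Rightarrow> 'a list set" where
  "words \<Sigma> k = {w. length w = k \<and> set w \<subseteq> \<Sigma>}"

definition occ_count :: "'a list \<Rightarrow> 'a list \<Rightarrow> nat" where
  "occ_count P S = card {i. i + length P \<le> length S \<and> take (length P) (drop i S) = P}"

definition capped_count :: "nat \<Rightarrow> 'a list \<Rightarrow> 'a list \<Rightarrow> nat" where
  "capped_count \<Delta> P S = min \<Delta> (occ_count P S)"

definition db_count :: "nat \<Rightarrow> 'a list \<Rightarrow> 'a list multiset \<Rightarrow> nat" where
  "db_count \<Delta> P D = (\<Sum>S\<in>#D. capped_count \<Delta> P S)"

definition databases :: "'a set \<Rightarrow> nat \<Rightarrow> nat \<Rightarrow> 'a list multiset set" where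
  "databases \<Sigma> l n = {D. size D = n \<and> set_mset D \<subseteq> words \<Sigma> l}"

definition neighboring :: "'a multiset \<Rightarrow> 'a multiset \<Rightarrow> bool" where
  "neighboring D D' \<longleftrightarrow> (\<exists>E S S'. D = add_mset S E \<and> D' = add_mset S' E)"

text \<open>A randomized algorithm maps a database and a threshold to the distribution of its output;
  only its behaviour on databases in \<open>\<D>\<close> is constrained.\<close>

definition differentially_private ::
  "real \<Rightarrow> 'a multiset set \<Rightarrow> ('a multiset \<Rightarrow> real \<Rightarrow> 'b pmf) \<Rightarrow> bool" where
  "differentially_private \<epsilon> \<D> A \<longleftrightarrow>
     (\<forall>D\<in>\<D>. \<forall>D'\<in>\<D>. neighboring D D' \<longrightarrow>
        (\<forall>\<tau> U. measure_pmf.prob (A D \<tau>) U \<le> exp \<epsilon> * measure_pmf.prob (A D' \<tau>) U))"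

definition mining_correct ::
  "'a set \<Rightarrow> nat \<Rightarrow> nat \<Rightarrow> real \<Rightarrow> 'a list multiset \<Rightarrow> real \<Rightarrow> 'a list set \<Rightarrow> bool" where
  "mining_correct \<Sigma> m \<Delta> \<alpha> D \<tau> \<P> \<longleftrightarrow>
     (\<forall>P\<in>words \<Sigma> m.
        (real (db_count \<Delta> P D) \<ge> \<tau> + \<alpha> \<longrightarrow> P \<in> \<P>) \<and>
        (real (db_count \<Delta> P D) \<le> \<tau> - \<alpha> \<longrightarrow> P \<notin> \<P>))"

end

theory Submission
  imports Defs
begin

text \<open>
  A packing argument. Cut a document of length \<open>l\<close> into \<open>k = l div m\<close> blocks of length \<open>m\<close>; the
  first \<open>m div 2\<close> letters of a block spell its index in binary over two reserved letters, the others
  are chosen freely among the non-reserved letters. The change from reserved to free letters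
  synchronises the blocks, so a block of one document occurs in another one only at its own
  position. Hence distinct documents, of which there are \<open>|\<Sigma>|\<^bsup>\<Omega>(l)\<^esup>\<close>, contain distinct sets of
  patterns. For a database with \<open>B\<close> copies of such a document and \<open>n - B\<close> neutral ones and the
  threshold \<open>B / 2\<close>, an error \<open>\<alpha> \<le> B / 2\<close> would make the sets of correct outputs disjoint,
  whereas by group privacy each of them has probability at least \<open>2 / 3 \<cdot> exp (- \<epsilon> B)\<close>
  on the neutral database.
\<close>

section \<open>Group privacy and packing\<close>

text \<open>For \<open>B = 0\<close> the document \<open>S\<close> disappears. So for
  \<open>B \<le> n\<close> all these databases, whatever \<open>S\<close>, are reached from the
  common database \<open>replicate_mset n Z\<close> by \<open>B\<close> replacements.\<close>

definition planted :: "'a \<Rightarrow> nat \<Rightarrow> 'a \<Rightarrow> nat \<Rightarrow> 'a multiset" where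
  "planted Z n S B = replicate_mset B S + replicate_mset (n - B) Z"

lemma neighboring_planted_Suc:
  assumes "Suc B \<le> n"
  shows "neighboring (planted Z n S (Suc B)) (planted Z n S B)"
proof -
  have "n - B = Suc (n - Suc B)"
    using assms by simp
  then show ?thesis
    unfolding neighboring_def planted_def
    by (intro exI[of _ "replicate_mset B S + replicate_mset (n - Suc B) Z"] exI[of _ S] exI[of _ Z])
      simp
qed

lemma planted_in_databases:
  assumes "S \<in> words \<Sigma> l" "Z \<in> words \<Sigma> l" "B \<le> n"
  shows "planted Z n S B \<in> databases \<Sigma> l n"
  using assms by (auto simp: databases_def planted_def)

lemma db_count_planted:
  "db_count \<Delta> P (planted Z n S B) = B * capped_count \<Delta> P S + (n - B) * capped_count \<Delta> P Z"
  by (simp add: db_count_def planted_def)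

text \<open>Turning the copies of \<open>S\<close> into \<open>Z\<close> one at a time costs a
  factor \<open>exp \<epsilon>\<close> each, and the final database no longer depends on
  \<open>S\<close>.\<close>

lemma group_privacy_planted:
  assumes dp: "differentially_private \<epsilon> (databases \<Sigma> l n) A"
    and S: "S \<in> words \<Sigma> l" and Z: "Z \<in> words \<Sigma> l" and "B \<le> n"
  shows "measure_pmf.prob (A (planted Z n S B) \<tau>) U
    \<le> exp (\<epsilon> * real B) * measure_pmf.prob (A (replicate_mset n Z) \<tau>) U"
  using \<open>B \<le> n\<close>
proof (induction B)
  case 0
  then show ?case by (simp add: planted_def)
next
  case (Suc B)
  have "measure_pmf.prob (A (planted Z n S (Suc B)) \<tau>) U
      \<le> exp \<epsilon> * measure_pmf.prob (A (planted Z n S B) \<tau>) U"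
    using dp planted_in_databases[OF S Z, of "Suc B" n] planted_in_databases[OF S Z, of B n]
      neighboring_planted_Suc[OF Suc.prems, of Z S] Suc.prems
    unfolding differentially_private_def by (meson Suc_leD)
  also have "\<dots> \<le> exp \<epsilon> *
      (exp (\<epsilon> * real B) * measure_pmf.prob (A (replicate_mset n Z) \<tau>) U)"
    using Suc by (intro mult_left_mono) auto
  also have "\<dots> = exp (\<epsilon> * real (Suc B)) * measure_pmf.prob (A (replicate_mset n Z) \<tau>) U"
    by (simp add: exp_add algebra_simps)
  finally show ?case .
qed

text \<open>All events are moved to one distribution, the output on the neutral database, where
  disjoint events have total probability at most 1.\<close>

lemma packing_bound:
  fixes A :: "'a list multiset \<Rightarrow> real \<Rightarrow> 'b pmf"
  assumes dp: "differentially_private \<epsilon> (databases \<Sigma> l n) A"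
    and "finite W" and S: "\<And>w. w \<in> W \<Longrightarrow> S w \<in> words \<Sigma> l"
    and Z: "Z \<in> words \<Sigma> l" and "B \<le> n"
    and disj: "disjoint_family_on U W"
    and p: "\<And>w. w \<in> W \<Longrightarrow> p \<le> measure_pmf.prob (A (planted Z n (S w) B) \<tau>) (U w)"
  shows "real (card W) * p \<le> exp (\<epsilon> * real B)"
proof -
  let ?M = "A (replicate_mset n Z) \<tau>"
  have "real (card W) * p = (\<Sum>w\<in>W. p)"
    by simp
  also have "\<dots> \<le> (\<Sum>w\<in>W. exp (\<epsilon> * real B) * measure_pmf.prob ?M (U w))"
    using p group_privacy_planted[OF dp S Z \<open>B \<le> n\<close>] by (intro sum_mono) (meson order_trans)
  also have "\<dots> = exp (\<epsilon> * real B) * measure_pmf.prob ?M (\<Union>w\<in>W. U w)"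
    using measure_pmf.finite_measure_finite_Union[OF \<open>finite W\<close> _ disj, of ?M]
    by (simp add: sum_distrib_left)
  also have "\<dots> \<le> exp (\<epsilon> * real B) * 1"
    by (intro mult_left_mono) auto
  finally show ?thesis by simp
qed

section \<open>Documents made of synchronising blocks\<close>

text \<open>Block \<open>j\<close> starts at position \<open>j * m\<close>. Its offsets below
  \<open>h\<close> hold the bits of \<open>j\<close>, lowest first, with \<open>b\<close> for 1 and
  \<open>a\<close> for 0; later offsets hold the free letters \<open>x\<close>. An incomplete last
  block is padded with the reserved letter \<open>a\<close>, so that it never looks free.\<close>

definition block_document ::
  "'a \<Rightarrow> 'a \<Rightarrow> nat \<Rightarrow> nat \<Rightarrow> nat \<Rightarrow> (nat \<times> nat \<Rightarrow> 'a) \<Rightarrow> 'a list" where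
  "block_document a b l m h x = map (\<lambda>i.
     if i div m < l div m \<and> h \<le> i mod m then x (i div m, i mod m)
     else if i div m < l div m \<and> bit (i div m) (i mod m) then b else a) [0..<l]"

lemma length_block_document [simp]: "length (block_document a b l m h x) = l"
  by (simp add: block_document_def)

lemma nth_block_document:
  "i < l \<Longrightarrow> block_document a b l m h x ! i =
     (if i div m < l div m \<and> h \<le> i mod m then x (i div m, i mod m)
      else if i div m < l div m \<and> bit (i div m) (i mod m) then b else a)"
  by (simp add: block_document_def)

lemma block_document_in_words:
  assumes "0 < m" "a \<in> \<Sigma>" "b \<in> \<Sigma>" "x \<in> {..<l div m} \<times> {h..<m} \<rightarrow> \<Sigma>"
  shows "block_document a b l m h x \<in> words \<Sigma> l"
  using assms by (auto simp: words_def block_document_def Pi_iff)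

lemma occ_count_pos_iff:
  "0 < occ_count P S \<longleftrightarrow>
     (\<exists>i. i + length P \<le> length S \<and> (\<forall>t<length P. S ! (i + t) = P ! t))"
proof -
  have eq: "take (length P) (drop i S) = P \<longleftrightarrow> (\<forall>t<length P. S ! (i + t) = P ! t)"
    if "i + length P \<le> length S" for i
    using that by (auto simp: list_eq_iff_nth_eq)
  have "finite {i. i + length P \<le> length S \<and> take (length P) (drop i S) = P}"
    by (rule finite_subset[of _ "{..length S}"]) auto
  then show ?thesis
    unfolding occ_count_def using eq by (auto simp: card_gt_0_iff)
qed

lemma block_index_less:
  fixes j m l r :: nat
  assumes "j < l div m" "r < m"
  shows "j * m + r < l"
proof -
  have "Suc j * m \<le> l div m * m"
    using assms by (intro mult_le_mono1) simp
  also have "\<dots> \<le> l"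
    by simp
  finally show ?thesis
    using assms by simp
qed

lemma eq_if_low_bits_eq:
  fixes q j :: nat
  assumes "q < 2 ^ h" "j < 2 ^ h" "\<And>t. t < h \<Longrightarrow> bit q t = bit j t"
  shows "q = j"
proof -
  have "take_bit h q = take_bit h j"
    using assms(3) by (auto simp: bit_eq_iff bit_take_bit_iff)
  then show ?thesis
    using assms(1,2) by (simp add: take_bit_nat_eq_self)
qed

text \<open>The last assumption excludes \<open>h = 0\<close>, where no reserved letters synchronise the blocks, unless
  the blocks are single letters.\<close>

lemma block_occurs_only_in_place:
  fixes l m h j p :: nat
  assumes m: "0 < m" "h < m" and lh: "l \<le> 2 ^ h" and ab: "a \<noteq> b"
    and x: "x \<in> {..<l div m} \<times> {h..<m} \<rightarrow> - {a, b}"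
    and y: "y \<in> {..<l div m} \<times> {h..<m} \<rightarrow> - {a, b}"
    and j: "j < l div m" and p: "p + m \<le> l"
    and occ: "\<And>t. t < m \<Longrightarrow>
      block_document a b l m h y ! (p + t) = block_document a b l m h x ! (j * m + t)"
    and h: "0 < h \<or> m = 1"
  shows "p = j * m"
proof -
  have X: "block_document a b l m h x ! (j * m + t) =
      (if h \<le> t then x (j, t) else if bit j t then b else a)" if "t < m" for t
    using that j block_index_less[OF j that] by (simp add: nth_block_document)
  \<comment> \<open>Offset \<open>h\<close> of block \<open>j\<close> holds a letter other than
    \<open>a\<close> and \<open>b\<close>, so its partner in the other document is a free position.
    In particular it is not in the padding.\<close>
  have free: "(p + h) div m < l div m \<and> h \<le> (p + h) mod m"
  proof (rule ccontr)
    assume "\<not> ?thesis"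
    then have "block_document a b l m h y ! (p + h) \<in> {a, b}"
      using p m by (subst nth_block_document) auto
    moreover have "x (j, h) \<in> - {a, b}"
      using x j m by auto
    ultimately show False
      using occ[OF \<open>h < m\<close>] X[OF \<open>h < m\<close>] by auto
  qed
  have aligned: "p mod m = 0"
  proof (cases "m = 1")
    case False
    then have "0 < h" using h by simp
    \<comment> \<open>The partner of offset \<open>h - 1\<close>, the last reserved letter of the
      block. It is not free while \<open>Suc i\<close> is, so the free part of a block begins at
      \<open>Suc i\<close>, which therefore has offset \<open>h\<close>.\<close>
    define i where "i = p + (h - 1)"
    have i: "Suc i = p + h" using \<open>0 < h\<close> by (simp add: i_def)
    have "h - 1 < m" using m by simp
    have "\<not> (i div m < l div m \<and> h \<le> i mod m)"
    proof
      assume *: "i div m < l div m \<and> h \<le> i mod m"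
      then have "y (i div m, i mod m) \<in> - {a, b}"
        using y m by auto
      moreover have "block_document a b l m h y ! i = y (i div m, i mod m)"
        using * i p m by (simp add: nth_block_document)
      ultimately show False
        using occ[OF \<open>h - 1 < m\<close>] X[OF \<open>h - 1 < m\<close>] \<open>0 < h\<close>
        by (auto simp: i_def split: if_splits)
    qed
    \<comment> \<open>A position that is not free lies in the padding or at an offset below
      \<open>h\<close>; the padding is excluded because \<open>Suc i\<close> lies in a full
      block.\<close>
    moreover have "i div m < l div m"
      using free i div_le_mono[of i "Suc i" m] by simp
    ultimately have "i mod m < h" by simp
    then have "Suc i mod m = h"
      using free m unfolding i[symmetric] by (auto simp: mod_Suc split: if_splits)
    then have "p + h = (p + h) div m * m + h"
      using i div_mult_mod_eq[of "p + h" m] by simp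
    then have "p = (p + h) div m * m"
      by simp
    then show ?thesis
      by (metis mod_mult_self2_is_0)
  qed simp
  define q where "q = p div m"
  have p_eq: "p = q * m"
    using aligned by (auto simp: q_def)
  have q: "q < l div m"
    using free m by (simp add: p_eq)
  \<comment> \<open>Thus \<open>h\<close> bits number all blocks, and equal reserved parts mean
    equal indices.\<close>
  have k: "l div m \<le> 2 ^ h"
    using lh div_le_dividend order_trans by blast
  have "q = j"
  proof (rule eq_if_low_bits_eq[of _ h])
    show "q < 2 ^ h" "j < 2 ^ h"
      using q j k by auto
    fix t assume "t < h"
    then have "t < m" using m by simp
    have "block_document a b l m h y ! (q * m + t) = (if bit q t then b else a)"
      using \<open>t < m\<close> \<open>t < h\<close> q block_index_less[OF q \<open>t < m\<close>] by (simp add: nth_block_document)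
    then show "bit q t = bit j t"
      using occ[OF \<open>t < m\<close>] X[OF \<open>t < m\<close>] \<open>t < h\<close> ab by (auto simp: p_eq split: if_splits)
  qed
  then show ?thesis by (simp add: p_eq)
qed

text \<open>\<open>P\<close> is a block in which \<open>x\<close> and \<open>y\<close> differ. In
  the document of \<open>y\<close> it could occur only at its own position, where the two disagree;
  in the constant document it cannot occur, as it contains a free letter.\<close>

lemma distinguishing_pattern:
  fixes l m h :: nat
  assumes m: "0 < m" "h < m" and lh: "l \<le> 2 ^ h" and ab: "a \<noteq> b" "a \<in> \<Sigma>" "b \<in> \<Sigma>"
    and x: "x \<in> {..<l div m} \<times> {h..<m} \<rightarrow>\<^sub>E \<Sigma> - {a, b}"
    and y: "y \<in> {..<l div m} \<times> {h..<m} \<rightarrow>\<^sub>E \<Sigma> - {a, b}"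
    and "x \<noteq> y" and h: "0 < h \<or> m = 1"
  obtains P where "P \<in> words \<Sigma> m" "0 < occ_count P (block_document a b l m h x)"
    "occ_count P (block_document a b l m h y) = 0" "occ_count P (replicate l a) = 0"
proof -
  \<comment> \<open>Members of \<open>PiE\<close> agree outside the domain, so the difference sits
    at a free position.\<close>
  obtain j r where jr: "j < l div m" "h \<le> r" "r < m" "x (j, r) \<noteq> y (j, r)"
    using PiE_ext[OF x y] \<open>x \<noteq> y\<close> by fastforce
  define P where "P = take m (drop (j * m) (block_document a b l m h x))"
  have jm: "j * m + m \<le> l"
    using block_index_less[OF jr(1), of "m - 1"] m by simp
  have len: "length P = m"
    using jm by (simp add: P_def)
  have nth: "P ! t = block_document a b l m h x ! (j * m + t)" if "t < m" for t
    using that jm by (simp add: P_def)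
  have val: "block_document a b l m h z ! (j * m + r) = z (j, r)" for z
    using jr block_index_less[OF jr(1,3)] by (simp add: nth_block_document)
  have xr: "x (j, r) \<in> \<Sigma> - {a, b}"
    using x jr by auto
  show thesis
  proof
    have "block_document a b l m h x \<in> words \<Sigma> l"
      using m ab x by (intro block_document_in_words) auto
    then show "P \<in> words \<Sigma> m"
      using len by (auto simp: words_def P_def dest!: in_set_takeD in_set_dropD)
    show "0 < occ_count P (block_document a b l m h x)"
      unfolding occ_count_pos_iff using len jm nth by auto
    show "occ_count P (block_document a b l m h y) = 0"
    proof (rule ccontr)
      assume "\<not> ?thesis"
      then obtain p where p: "p + m \<le> l"
        "\<And>t. t < m \<Longrightarrow> block_document a b l m h y ! (p + t) = P ! t"
        using occ_count_pos_iff[of P "block_document a b l m h y"] len by auto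
      have "p = j * m"
      proof (rule block_occurs_only_in_place[OF m lh ab(1) _ _ jr(1) p(1) _ h])
        show "x \<in> {..<l div m} \<times> {h..<m} \<rightarrow> - {a, b}" "y \<in> {..<l div m} \<times> {h..<m} \<rightarrow> - {a, b}"
          using x y by (auto simp: PiE_def Pi_def)
      qed (use p nth in auto)
      then show False
        using p(2)[OF jr(3)] nth[OF jr(3)] val jr(4) by simp
    qed
    show "occ_count P (replicate l a) = 0"
    proof (rule ccontr)
      assume "\<not> ?thesis"
      then obtain p where "p + m \<le> l" "replicate l a ! (p + r) = P ! r"
        using occ_count_pos_iff[of P "replicate l a"] len jr(3) by auto
      then show False
        using nth[OF jr(3)] val xr jr(3) by simp
    qed
  qed
qed

text \<open>The count of \<open>P\<close> is at least \<open>B\<close> in one database and 0 in the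
  other. Both are at distance at least \<open>\<alpha>\<close> from the threshold
  \<open>B / 2\<close>, so \<open>P\<close> must be reported for the first and omitted for the
  second.\<close>

lemma correct_outputs_disjoint:
  assumes P: "P \<in> words \<Sigma> m" "0 < occ_count P S" "occ_count P S' = 0" "occ_count P Z = 0"
    and \<Delta>: "1 \<le> \<Delta>" and \<alpha>: "\<alpha> \<le> real B / 2"
  shows "{\<P>. mining_correct \<Sigma> m \<Delta> \<alpha> (planted Z n S B) (real B / 2) \<P>} \<inter>
    {\<P>. mining_correct \<Sigma> m \<Delta> \<alpha> (planted Z n S' B) (real B / 2) \<P>} = {}"
proof -
  have "1 \<le> capped_count \<Delta> P S"
    using P \<Delta> by (simp add: capped_count_def)
  then have "B \<le> db_count \<Delta> P (planted Z n S B)"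
    by (simp add: db_count_planted trans_le_add1)
  then have "real B / 2 + \<alpha> \<le> real (db_count \<Delta> P (planted Z n S B))"
    using \<alpha> by linarith
  moreover have "db_count \<Delta> P (planted Z n S' B) = 0"
    using P by (simp add: db_count_planted capped_count_def)
  then have "real (db_count \<Delta> P (planted Z n S' B)) \<le> real B / 2 - \<alpha>"
    using \<alpha> by simp
  ultimately show ?thesis
    using P(1) by (auto simp: mining_correct_def)
qed

section \<open>The lower bound\<close>

text \<open>Absorbs the success probability into a constant: \<open>(2 / 3 * N) ^ 4\<close> is
  \<open>N\<close> times \<open>16 / 81 * N ^ 3\<close>, and the latter is at least 128/81.\<close>

lemma ln_two_thirds_ge:
  assumes "2 \<le> N"
  shows "ln N / 4 \<le> ln (2 / 3 * N :: real)"
proof -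
  have "N \<le> (2 / 3 * N) ^ 4"
  proof -
    have "2 ^ 3 \<le> N ^ 3"
      using assms by (intro power_mono) auto
    then have "N * 1 \<le> N * (16 / 81 * N ^ 3)"
      using assms by (intro mult_left_mono) auto
    then show ?thesis
      by (simp add: power_mult_distrib power_divide power_numeral_reduce)
  qed
  then have "ln N \<le> ln ((2 / 3 * N) ^ 4)"
    using assms by (subst ln_le_cancel_iff) auto
  also have "\<dots> = 4 * ln (2 / 3 * N)"
    using assms by (subst ln_realpow) auto
  finally show ?thesis by simp
qed

text \<open>Reserving two letters at most halves the logarithm of the alphabet size, since
  \<open>(s - 2)^2 - s = (s - 1) * (s - 4)\<close>.\<close>

lemma ln_card_minus_two_ge:
  assumes "4 \<le> s"
  shows "ln (real s) / 2 \<le> ln (real (s - 2))"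
proof -
  have "0 \<le> (real s - 1) * (real s - 4)"
    using assms by (intro mult_nonneg_nonneg) auto
  then have "real s \<le> real (s - 2) ^ 2"
    using assms by (simp add: power2_eq_square algebra_simps)
  then have "ln (real s) \<le> ln (real (s - 2) ^ 2)"
    using assms by (subst ln_le_cancel_iff) auto
  also have "\<dots> = 2 * ln (real (s - 2))"
    using assms by (subst ln_realpow) auto
  finally show ?thesis by simp
qed

text \<open>The full blocks cover at least half of the document, and at least half of each block is
  free.\<close>

lemma free_positions_ge:
  fixes l m :: nat
  assumes "1 \<le> m" "m \<le> l"
  shows "l \<le> 4 * (l div m * (m - m div 2))"
proof -
  have k: "1 \<le> l div m"
    using assms by (simp add: Suc_le_eq div_greater_zero_iff)
  have "l mod m < m" "l = l div m * m + l mod m"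
    using assms by auto
  moreover have "m \<le> l div m * m"
    using k by simp
  ultimately have "l \<le> 2 * (l div m * m)"
    by linarith
  also have "\<dots> \<le> 2 * (l div m * (2 * (m - m div 2)))"
    by (intro mult_le_mono) auto
  finally show ?thesis by simp
qed

text \<open>The constant is 64 = 4 * 2 * 4 * 2: positions that are not free, the two reserved
  letters, the factor 2/3, and the passage from \<open>ln\<close> to \<open>log 2\<close>. The last
  step makes the inequality strict.\<close>

lemma packing_size_lower_bound:
  fixes s l m :: nat
  assumes "4 \<le> s" "1 \<le> m" "m \<le> l"
  defines "N \<equiv> (s - 2) ^ (l div m * (m - m div 2))"
  shows "real l * log 2 (real s) < 64 * ln (2 / 3 * real N)"
proof -
  define e where "e = l div m * (m - m div 2)"
  have le: "real l \<le> 4 * real e"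
    using free_positions_ge[OF assms(2,3)] unfolding e_def by linarith
  then have "1 \<le> e"
    using assms(2,3) by linarith
  have "2 ^ 1 \<le> (2 :: nat) ^ e"
    using \<open>1 \<le> e\<close> by (intro power_increasing) auto
  also have "\<dots> \<le> N"
    unfolding N_def e_def[symmetric] using assms(1) by (intro power_mono) auto
  finally have N2: "2 \<le> real N" by simp
  have ln_s: "0 < ln (real s)"
    using assms(1) by simp
  have half: "1 / 2 < ln (2 :: real)"
    using ln2_ge_two_thirds by linarith
  have "real l * ln (real s) \<le> (4 * real e) * (2 * ln (real (s - 2)))"
    using le ln_card_minus_two_ge[OF assms(1)] ln_s by (intro mult_mono) auto
  also have "\<dots> = 8 * ln (real N)"
    unfolding N_def e_def[symmetric] using assms(1) by (simp add: ln_realpow)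
  also have "\<dots> \<le> 32 * ln (2 / 3 * real N)"
    using ln_two_thirds_ge[OF N2] by simp
  finally have le32: "real l * ln (real s) \<le> 32 * ln (2 / 3 * real N)" .
  have pos: "0 < real l * ln (real s)"
    using ln_s assms(2,3) by simp
  have "real l * log 2 (real s) = real l * ln (real s) / ln 2"
    by (simp add: log_def)
  also have "\<dots> < real l * ln (real s) / (1 / 2)"
    using pos half by (intro divide_strict_left_mono) auto
  also have "\<dots> \<le> 64 * ln (2 / 3 * real N)"
    using le32 by simp
  finally show ?thesis .
qed

text \<open>Turns the hypothesis on \<open>m\<close> into the statement that half a block has room
  for the index of every block.\<close>

lemma length_le_two_power_half:
  assumes "int m \<ge> 2 * \<lceil>log 2 (real l)\<rceil>" "1 \<le> l"
  shows "l \<le> 2 ^ (m div 2)"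
proof -
  have "\<lceil>log 2 (real l)\<rceil> \<le> int (m div 2)"
    using assms(1) by linarith
  then have "log 2 (real l) \<le> real (m div 2)"
    by linarith
  then have "real l \<le> 2 powr real (m div 2)"
    using assms(2) by (simp add: log_le_iff)
  then show ?thesis
    by (metis of_nat_le_iff of_nat_numeral of_nat_power powr_realpow zero_less_numeral)
qed

text \<open>Otherwise the packing bound gives
  \<open>ln (2 / 3 * card W) \<le> \<epsilon> * B\<close>, whereas the choice of \<open>B\<close>
  and the size of \<open>W\<close> force the strict reverse inequality.\<close>

lemma error_exceeds_half_copies:
  fixes Alg :: "'a list multiset \<Rightarrow> real \<Rightarrow> 'a list set pmf"
  assumes "finite \<Sigma>" "4 \<le> card \<Sigma>" and m: "int m \<ge> 2 * \<lceil>log 2 (real l)\<rceil>" "1 \<le> m" "m \<le> l"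
    and "1 \<le> \<Delta>"
    and dp: "differentially_private \<epsilon> (databases \<Sigma> l n) Alg"
    and correct: "\<And>D \<tau>. D \<in> databases \<Sigma> l n \<Longrightarrow>
      measure_pmf.prob (Alg D \<tau>) {\<P>. mining_correct \<Sigma> m \<Delta> \<alpha> D \<tau> \<P>} \<ge> 2 / 3"
    and "B \<le> n" and B: "64 * (\<epsilon> * real B) \<le> real l * log 2 (real (card \<Sigma>))"
  shows "real B / 2 < \<alpha>"
proof (rule ccontr)
  assume "\<not> ?thesis"
  then have \<alpha>: "\<alpha> \<le> real B / 2" by simp
  define h where "h = m div 2"
  have h: "h < m" "0 < h \<or> m = 1" and m0: "0 < m"
    using m(2) by (auto simp: h_def)
  have lh: "l \<le> 2 ^ h"
    unfolding h_def using m by (intro length_le_two_power_half) auto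
  obtain T where "T \<subseteq> \<Sigma>" "card T = 2"
    using obtain_subset_with_card_n[of 2 \<Sigma>] assms(2) by auto
  then obtain a b where ab: "a \<in> \<Sigma>" "b \<in> \<Sigma>" "a \<noteq> b"
    by (auto simp: card_2_iff)
  define W where "W = {..<l div m} \<times> {h..<m} \<rightarrow>\<^sub>E \<Sigma> - {a, b}"
  define S where "S = block_document a b l m h"
  define Z where "Z = replicate l a"
  define U where
    "U x = {\<P>. mining_correct \<Sigma> m \<Delta> \<alpha> (planted Z n (S x) B) (real B / 2) \<P>}" for x
  have "finite W"
    unfolding W_def using assms(1) by (intro finite_PiE) auto
  have S: "S x \<in> words \<Sigma> l" if "x \<in> W" for x
    unfolding S_def using that m0 ab by (intro block_document_in_words) (auto simp: W_def)
  have Z: "Z \<in> words \<Sigma> l"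
    using ab by (auto simp: Z_def words_def)
  have "U x \<inter> U y = {}" if "x \<in> W" "y \<in> W" "x \<noteq> y" for x y
    using distinguishing_pattern[OF m0 h(1) lh ab(3,1,2) that[unfolded W_def] h(2)]
      correct_outputs_disjoint[OF _ _ _ _ \<open>1 \<le> \<Delta>\<close> \<alpha>]
    unfolding U_def S_def Z_def by metis
  then have disj: "disjoint_family_on U W"
    by (auto simp: disjoint_family_on_def)
  have "real (card W) * (2 / 3) \<le> exp (\<epsilon> * real B)"
  proof (rule packing_bound[OF dp \<open>finite W\<close> S Z \<open>B \<le> n\<close> disj])
    show "2 / 3 \<le> measure_pmf.prob (Alg (planted Z n (S x) B) (real B / 2)) (U x)" if "x \<in> W" for x
      unfolding U_def using S[OF that] Z \<open>B \<le> n\<close> by (intro correct planted_in_databases)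
  qed
  \<comment> \<open>There are \<open>m - h\<close> free offsets in each of \<open>l div m\<close>
    blocks, and \<open>card \<Sigma> - 2\<close> letters for each of them.\<close>
  moreover have card_W: "card W = (card \<Sigma> - 2) ^ (l div m * (m - m div 2))"
    using ab assms(1) by (simp add: W_def card_PiE card_Diff_subset h_def numeral_2_eq_2)
  moreover have "0 < card W"
    using card_W assms(2) by simp
  ultimately have "ln (2 / 3 * real (card W)) \<le> ln (exp (\<epsilon> * real B))"
    by (subst ln_le_cancel_iff) (auto simp: mult.commute)
  then show False
    using packing_size_lower_bound[OF assms(2) m(2,3)] B card_W by simp
qed

theorem theorem1p5:
  "\<exists>c>0. \<exists>K>0. \<forall>(n::nat) (l::nat) (m::nat) (\<Delta>::nat) (\<Sigma>::nat set) (\<epsilon>::real) (\<alpha>::real)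
      (Alg :: nat list multiset \<Rightarrow> real \<Rightarrow> nat list set pmf).
      finite \<Sigma> \<longrightarrow> card \<Sigma> \<ge> 4 \<longrightarrow>
      int m \<ge> 2 * \<lceil>log 2 (real l)\<rceil> \<longrightarrow> 1 \<le> m \<longrightarrow> m \<le> l \<longrightarrow>
      1 \<le> \<Delta> \<longrightarrow> \<Delta> \<le> l \<longrightarrow> \<epsilon> > 0 \<longrightarrow>
      differentially_private \<epsilon> (databases \<Sigma> l n) Alg \<longrightarrow>
      (\<forall>D\<in>databases \<Sigma> l n. \<forall>\<tau>.
         measure_pmf.prob (Alg D \<tau>) {\<P>. mining_correct \<Sigma> m \<Delta> \<alpha> D \<tau> \<P>} \<ge> 2 / 3) \<longrightarrow>
      (\<alpha> \<ge> 1 \<or> min (real n) (real l * log 2 (real (card \<Sigma>)) / \<epsilon>) \<ge> K) \<longrightarrow>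
      \<alpha> \<ge> c * min (real n) (real l * log 2 (real (card \<Sigma>)) / \<epsilon>)"
proof (rule exI[of _ "1 / 256"], intro conjI exI[of _ 64] allI impI)
  fix n l m \<Delta> :: nat and \<Sigma> :: "nat set" and \<epsilon> \<alpha> :: real
    and Alg :: "nat list multiset \<Rightarrow> real \<Rightarrow> nat list set pmf"
  define M where "M = min (real n) (real l * log 2 (real (card \<Sigma>)) / \<epsilon>)"
  assume asm: "finite \<Sigma>" "4 \<le> card \<Sigma>" "int m \<ge> 2 * \<lceil>log 2 (real l)\<rceil>" "1 \<le> m" "m \<le> l" "1 \<le> \<Delta>"
    and "\<epsilon> > 0" and dp: "differentially_private \<epsilon> (databases \<Sigma> l n) Alg"
    and correct: "\<forall>D\<in>databases \<Sigma> l n. \<forall>\<tau>.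
      measure_pmf.prob (Alg D \<tau>) {\<P>. mining_correct \<Sigma> m \<Delta> \<alpha> D \<tau> \<P>} \<ge> 2 / 3"
    and "\<alpha> \<ge> 1 \<or> min (real n) (real l * log 2 (real (card \<Sigma>)) / \<epsilon>) \<ge> 64"
  \<comment> \<open>From 64 on at least one copy can be planted. Below 64,
    \<open>\<alpha> \<ge> 1\<close> suffices, as \<open>M / 256\<close> is less than 1/4.\<close>
  then consider "64 \<le> M" | "M < 64" "1 \<le> \<alpha>"
    unfolding M_def by linarith
  then have "1 / 256 * M \<le> \<alpha>"
  proof cases
    case 1
    \<comment> \<open>The divisor is the constant 64 of the packing size, so \<open>B\<close> is
      about the largest number of copies allowed.\<close>
    define B where "B = nat \<lfloor>M / 64\<rfloor>"
    have B: "real B \<le> M / 64" "M / 64 - 1 < real B"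
      using 1 unfolding B_def by linarith+
    have "1 \<le> B"
      using 1 by (simp add: B_def le_nat_iff le_floor_iff)
    have "M \<le> real n" "M \<le> real l * log 2 (real (card \<Sigma>)) / \<epsilon>"
      by (auto simp: M_def)
    then have "B \<le> n" "64 * real B \<le> real l * log 2 (real (card \<Sigma>)) / \<epsilon>"
      using B 1 by linarith+
    then have "64 * (\<epsilon> * real B) \<le> real l * log 2 (real (card \<Sigma>))"
      using \<open>\<epsilon> > 0\<close> by (simp add: field_simps)
    then have "real B / 2 < \<alpha>"
      using error_exceeds_half_copies[OF asm dp _ \<open>B \<le> n\<close>] correct by blast
    then show ?thesis
      \<comment> \<open>Rounding down at most halves: \<open>B \<ge> 1\<close> and
        \<open>B > M / 64 - 1\<close> give \<open>2 * B > M / 64\<close>, hence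
        \<open>B / 2 > M / 256\<close>.\<close>
      using B \<open>1 \<le> B\<close> by linarith
  qed simp
  then show "1 / 256 * min (real n) (real l * log 2 (real (card \<Sigma>)) / \<epsilon>) \<le> \<alpha>"
    by (simp add: M_def)
qed simp_all

end
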